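(* Let $\tau>0$, let $(\lambda(\tau),u(x,\tau))=\left(\frac{2\tau^2}{\cosh^2\tau},\,2\log\frac{\cosh\tau}{\cosh(\tau x)}\right)$, and let $\{\mu_j\}_{j=1}^{\infty}$, $\mu_1<\mu_2<\cdots$, be the eigenvalues (depending on $\tau$) of the problem $$\varphi''+\lambda(\tau)e^{u(x,\tau)}\varphi=-\mu\varphi\ \ (-1<x<1),\qquad \varphi(-1)=\varphi(1)=0.$$ Let $\tau_1$ be the unique solution of $\tau\tanh\tau=1$, $\tau>0$. For $j\ge 1$ consider the condition $$(\ast)_j\qquad \tan\left(\sqrt{\mu_j}-\frac{\pi}{2}(j-1)\right)=\frac{\sqrt{\mu_j}}{\tau\tanh\tau}\quad\text{and}\quad \frac{\pi}{2}(j-1)<\sqrt{\mu_j}<\frac{\pi}{2}j.$$ Then the following hold: (i) If $0<\tau<\tau_1$, then for every $j\ge 1$, $\mu_j>0$ and $\mu_j$ is the unique solution of $(\ast)_j$. (ii) If $\tau=\tau_1$, then $\mu_1=0$, and for every $j\ge 2$, $\mu_j>0$ and $\mu_j$ satisfies $(\ast)_j$. (iii) If $\tau>\tau_1$, then $\mu_1<0$ and $\mu_1$ is the unique negative solution of $$\tanh\sqrt{-\mu_1}=\frac{\sqrt{-\mu_1}}{\tau\tanh\tau},$$ and for every $j\ge 2$, $\mu_j>0$ and $\mu_j$ satisfies $(\ast)_j$.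
   Context: The pairs $(\lambda(\tau),u(\cdot,\tau))$, $\tau>0$, are exactly the positive solutions of the one-dimensional Gel'fand problem $u''+\lambda e^u=0$ on $(-1,1)$, $u(\pm1)=0$, with $\lambda>0$; the eigenvalue problem in the statement is its linearization at the solution. Primes denote derivatives in $x$. An eigenvalue is a number $\mu$ for which the boundary value problem has a nontrivial solution; by classical Sturm–Liouville theory all eigenvalues are real and simple and can be listed as a strictly increasing sequence. *)

theory Defs
  imports Complex_Main
begin

definition gelfand_lambda :: "real \<Rightarrow> real" where
  "gelfand_lambda \<tau> = 2 * \<tau>\<^sup>2 / (cosh \<tau>)\<^sup>2"

definition gelfand_u :: "real \<Rightarrow> real \<Rightarrow> real" where
  "gelfand_u x \<tau> = 2 * ln (cosh \<tau> / cosh (\<tau> * x))"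

text \<open>
  Nontrivial classical solutions of \<open>\<phi>'' + q \<phi> = - \<mu> \<phi>\<close> on \<open>(-1, 1)\<close> with \<open>\<phi> (-1) = \<phi> 1 = 0\<close>;
  \<open>d\<phi>\<close> and \<open>dd\<phi>\<close> are the first and second derivatives. Continuity up to the
  end points is what ties the boundary values to the solution in the open interval.
\<close>

definition dirichlet_eigenfunction :: "(real \<Rightarrow> real) \<Rightarrow> real \<Rightarrow> (real \<Rightarrow> real) \<Rightarrow> bool" where
  "dirichlet_eigenfunction q \<mu> \<phi> \<longleftrightarrow>
     continuous_on {-1..1} \<phi> \<and>
     (\<exists>d\<phi> dd\<phi>. \<forall>x\<in>{-1<..<1}.
        (\<phi> has_real_derivative d\<phi> x) (at x) \<and>
        (d\<phi> has_real_derivative dd\<phi> x) (at x) \<and>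
        dd\<phi> x + q x * \<phi> x = - \<mu> * \<phi> x) \<and>
     \<phi> (-1) = 0 \<and> \<phi> 1 = 0 \<and>
     (\<exists>x\<in>{-1..1}. \<phi> x \<noteq> 0)"

definition dirichlet_eigenvalue :: "(real \<Rightarrow> real) \<Rightarrow> real \<Rightarrow> bool" where
  "dirichlet_eigenvalue q \<mu> \<longleftrightarrow> (\<exists>\<phi>. dirichlet_eigenfunction q \<mu> \<phi>)"

definition gelfand_eigenvalue :: "real \<Rightarrow> real \<Rightarrow> bool" where
  "gelfand_eigenvalue \<tau> = dirichlet_eigenvalue (\<lambda>x. gelfand_lambda \<tau> * exp (gelfand_u x \<tau>))"

definition tau1 :: real where
  "tau1 = (THE \<tau>. 0 < \<tau> \<and> \<tau> * tanh \<tau> = 1)"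

text \<open>
  For \<open>j \<ge> 1\<close> the strict bounds force \<open>sqrt \<mu> > 0\<close>, hence \<open>\<mu> > 0\<close> (the library's
  \<open>sqrt\<close> is negative at negative arguments), and keep the argument of \<open>tan\<close> in \<open>(0, pi/2)\<close>.
\<close>

definition star_condition :: "real \<Rightarrow> nat \<Rightarrow> real \<Rightarrow> bool" where
  "star_condition \<tau> j \<mu> \<longleftrightarrow>
     tan (sqrt \<mu> - pi / 2 * (real j - 1)) = sqrt \<mu> / (\<tau> * tanh \<tau>) \<and>
     pi / 2 * (real j - 1) < sqrt \<mu> \<and> sqrt \<mu> < pi / 2 * real j"

end

theory Submission
  imports Defs "HOL-Analysis.Abstract_Topology_2"
begin

text \<open>
  The linearized equation is exactly solvable. Put \<open>T x = \<tau> * tanh (\<tau> * x)\<close> and \<open>K = T 1\<close>. The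
  potential is \<open>2 T'\<close> and \<open>T' = \<tau>\<^sup>2 - T\<^sup>2\<close>, so the Darboux transformation \<open>\<psi> \<mapsto> \<psi>' - T \<psi>\<close> maps
  solutions of \<open>\<psi>'' = - \<mu> \<psi>\<close> to solutions of \<open>\<phi>'' + 2 T' \<phi> = - \<mu> \<phi>\<close>
  (\<open>gelfand_eigenvalue_iff_darboux\<close>). It yields an even and an odd solution, independent except at
  \<open>\<mu> = - \<tau>\<^sup>2\<close>, which is treated by hand and is not an eigenvalue. By symmetry, \<open>\<mu>\<close> is an eigenvalue
  if and only if one of the two vanishes at \<open>1\<close> (\<open>dirichlet_eigenvalue_iff_even_odd\<close>).

  The resulting characteristic equations are as follows. For \<open>\<mu> = - \<kappa>\<^sup>2 < 0\<close> the equation is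
  \<open>tanh \<kappa> = \<kappa> / K\<close>; for \<open>\<mu> = 0\<close> it is \<open>K = 1\<close>; for \<open>\<mu> = \<nu>\<^sup>2 > 0\<close> it is \<open>tan \<nu> = \<nu> / K\<close> (even
  eigenfunctions) or \<open>- cot \<nu> = \<nu> / K\<close> (odd ones). The last two are exchanged by a quarter turn of the
  angle, and \<open>tan\<close> is positive only on every other quarter, so together they say that the condition on
  \<open>tan (\<nu> - pi / 2 * (j - 1))\<close> holds for some \<open>j\<close> (\<open>gelfand_eigenvalue_positive_iff\<close>).

  Monotonicity of \<open>tan \<theta> / (\<theta> + a)\<close> and of \<open>tanh \<kappa> / \<kappa>\<close> then counts the solutions. For \<open>j \<ge> 2\<close> there
  is always exactly one. The lowest eigenvalue depends on \<open>K\<close>: it comes from \<open>j = 1\<close> if \<open>K < 1\<close>, is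
  \<open>0\<close> if \<open>K = 1\<close>, and is the negative root of \<open>tanh \<kappa> = \<kappa> / K\<close> if \<open>K > 1\<close>. Since \<open>\<tau> * tanh \<tau>\<close> is
  increasing, these are the cases \<open>\<tau> < tau1\<close>, \<open>\<tau> = tau1\<close> and \<open>\<tau> > tau1\<close>. An increasing enumeration
  of a set is unique, so the explicit list is the given sequence
  (\<open>enumeration_of_gelfand_spectrum\<close>).
\<close>

section \<open>Dirichlet eigenvalues from an even and an odd solution\<close>

text \<open>
  An eigenfunction is differentiable only inside the interval, so its representation by a
  fundamental system is first found there; continuity carries it to the end points, where the
  boundary conditions are read off.
\<close>

lemma linear_combination_extends_to_endpoints:
  fixes \<phi> y z :: "real \<Rightarrow> real"
  assumes "continuous_on {-1..1} \<phi>" "continuous_on {-1..1} y" "continuous_on {-1..1} z"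
    and "\<And>x. x \<in> {-1<..<1} \<Longrightarrow> \<phi> x * w = A * y x - B * z x"
    and "x \<in> {-1..1}"
  shows "\<phi> x * w = A * y x - B * z x"
proof -
  have "\<phi> x * w - (A * y x - B * z x) = 0"
  proof (rule continuous_constant_on_closure[of "{-1<..<1}" "\<lambda>x. \<phi> x * w - (A * y x - B * z x)"])
    show "continuous_on (closure {-1<..<1}) (\<lambda>x. \<phi> x * w - (A * y x - B * z x))"
      using assms(1-3) by (auto intro!: continuous_intros)
  qed (use assms in auto)
  then show ?thesis by simp
qed

text \<open>
  A solution is a combination \<open>A y - B z\<close> of the even and the odd fundamental solution. The
  boundary conditions say \<open>A y(1) - B z(1) = 0\<close> and \<open>A y(1) + B z(1) = 0\<close>, that is
  \<open>A y(1) = B z(1) = 0\<close>, so a nontrivial choice of \<open>A\<close>, \<open>B\<close> exists exactly when \<open>y\<close> or \<open>z\<close>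
  vanishes at \<open>1\<close>.
\<close>

lemma dirichlet_eigenvalue_iff_even_odd:
  fixes q y z dy dz :: "real \<Rightarrow> real"
  assumes y: "\<And>x. (y has_real_derivative dy x) (at x)"
    and dy: "\<And>x. (dy has_real_derivative - (q x + \<mu>) * y x) (at x)"
    and z: "\<And>x. (z has_real_derivative dz x) (at x)"
    and dz: "\<And>x. (dz has_real_derivative - (q x + \<mu>) * z x) (at x)"
    and even: "\<And>x. y (- x) = y x" and odd: "\<And>x. z (- x) = - z x"
    and y0: "y 0 \<noteq> 0" and dz0: "dz 0 \<noteq> 0"
  shows "dirichlet_eigenvalue q \<mu> \<longleftrightarrow> y 1 = 0 \<or> z 1 = 0"
proof
  have cont_y: "continuous_on {-1..1} y" and cont_z: "continuous_on {-1..1} z"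
    using y z by (auto intro!: continuous_at_imp_continuous_on DERIV_isCont)
  \<comment> \<open>The first solution is allowed to be one on the open interval only, as the eigenfunction is.\<close>
  have wronskian_const:
    "f a * dg a - df a * g a = f b * dg b - df b * g b"
    if "a \<in> {-1<..<1}" "b \<in> {-1<..<1}"
      and f: "\<And>x. x \<in> {-1<..<1} \<Longrightarrow> (f has_real_derivative df x) (at x)"
      and df: "\<And>x. x \<in> {-1<..<1} \<Longrightarrow> (df has_real_derivative - (q x + \<mu>) * f x) (at x)"
      and g: "\<And>x. (g has_real_derivative dg x) (at x)"
      and dg: "\<And>x. (dg has_real_derivative - (q x + \<mu>) * g x) (at x)"
    for a b :: real and f df g dg :: "real \<Rightarrow> real"
  proof (rule DERIV_isconst3[of "-1" 1 a b "\<lambda>x. f x * dg x - df x * g x"])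
    show "((\<lambda>x. f x * dg x - df x * g x) has_real_derivative 0) (at x)"
      if "x \<in> {-1<..<1}" for x
      by (rule derivative_eq_intros f[OF that] df[OF that] g dg refl)+ (simp add: algebra_simps)
  qed (use that in auto)
  have z0: "z 0 = 0" using odd[of 0] by simp
  show "y 1 = 0 \<or> z 1 = 0" if "dirichlet_eigenvalue q \<mu>"
  proof (rule ccontr)
    assume nz: "\<not> (y 1 = 0 \<or> z 1 = 0)"
    from that obtain \<phi> d\<phi> dd\<phi> where
      cont: "continuous_on {-1..1} \<phi>" and
      ode: "\<And>x. x \<in> {-1<..<1} \<Longrightarrow> (\<phi> has_real_derivative d\<phi> x) (at x) \<and>
        (d\<phi> has_real_derivative dd\<phi> x) (at x) \<and> dd\<phi> x + q x * \<phi> x = - \<mu> * \<phi> x" and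
      bc: "\<phi> (-1) = 0" "\<phi> 1 = 0" and nontriv: "\<exists>x\<in>{-1..1}. \<phi> x \<noteq> 0"
      unfolding dirichlet_eigenvalue_def dirichlet_eigenfunction_def by blast
    have \<phi>: "(\<phi> has_real_derivative d\<phi> x) (at x)" if "x \<in> {-1<..<1}" for x
      using ode[OF that] by blast
    have d\<phi>: "(d\<phi> has_real_derivative - (q x + \<mu>) * \<phi> x) (at x)" if "x \<in> {-1<..<1}" for x
    proof -
      have "dd\<phi> x = - (q x + \<mu>) * \<phi> x" using ode[OF that] by (simp add: algebra_simps)
      with ode[OF that] show ?thesis by metis
    qed
    define A where "A = \<phi> 0 * dz 0 - d\<phi> 0 * z 0"
    define B where "B = \<phi> 0 * dy 0 - d\<phi> 0 * y 0"
    define w where "w = y 0 * dz 0 - dy 0 * z 0"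
    have w: "w \<noteq> 0" using y0 dz0 z0 by (simp add: w_def)
    \<comment> \<open>Cramer's rule: the three Wronskians are constant, and they express the solution through
      the fundamental system.\<close>
    have "\<phi> x * w = A * y x - B * z x" if x: "x \<in> {-1<..<1}" for x
    proof -
      have 1: "A = \<phi> x * dz x - d\<phi> x * z x" unfolding A_def
        by (rule wronskian_const) (use x \<phi> d\<phi> z dz in auto)
      have 2: "B = \<phi> x * dy x - d\<phi> x * y x" unfolding B_def
        by (rule wronskian_const) (use x \<phi> d\<phi> y dy in auto)
      have 3: "w = y x * dz x - dy x * z x" unfolding w_def
        by (rule wronskian_const) (use x y dy z dz in auto)
      show ?thesis unfolding 1 2 3 by (simp add: algebra_simps)
    qed
    then have rep: "\<phi> x * w = A * y x - B * z x" if "x \<in> {-1..1}" for x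
      by (rule linear_combination_extends_to_endpoints[OF cont cont_y cont_z _ that])
    have "A * y 1 - B * z 1 = 0" "A * y 1 + B * z 1 = 0"
      using rep[of 1] rep[of "-1"] bc even[of 1] odd[of 1] by auto
    then have "A * y 1 = 0" "B * z 1 = 0" by linarith+
    with nz have "A = 0" "B = 0" by auto
    with rep w have "\<forall>x\<in>{-1..1}. \<phi> x = 0" by simp
    with nontriv show False by blast
  qed
  show "dirichlet_eigenvalue q \<mu>" if "y 1 = 0 \<or> z 1 = 0"
    using that
  proof
    assume y1: "y 1 = 0"
    have "dirichlet_eigenfunction q \<mu> y"
      unfolding dirichlet_eigenfunction_def
    proof (intro conjI exI ballI)
      show "\<exists>x\<in>{-1..1}. y x \<noteq> 0" using y0 by (intro bexI[of _ 0]) auto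
    qed (use y dy cont_y y1 even[of 1] in \<open>auto simp: algebra_simps\<close>)
    then show ?thesis unfolding dirichlet_eigenvalue_def by blast
  next
    assume z1: "z 1 = 0"
    have "dirichlet_eigenfunction q \<mu> z"
      unfolding dirichlet_eigenfunction_def
    proof (intro conjI exI ballI)
      show "\<exists>x\<in>{-1..1}. z x \<noteq> 0"
      proof (rule ccontr)
        assume "\<not> (\<exists>x\<in>{-1..1}. z x \<noteq> 0)"
        then have "\<forall>x. \<bar>0 - x\<bar> < 1 \<longrightarrow> z 0 = z x"
          using z0 by (simp add: abs_less_iff)
        from DERIV_local_const[OF z _ this] have "dz 0 = 0" by simp
        with dz0 show False by simp
      qed
    qed (use z dz cont_z z1 odd[of 1] in \<open>auto simp: algebra_simps\<close>)
    then show ?thesis unfolding dirichlet_eigenvalue_def by blast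
  qed
qed

section \<open>Explicit solutions of the linearized equation\<close>

text \<open>
  In terms of \<open>T x = \<tau> * tanh (\<tau> * x)\<close> the potential is \<open>2 T'\<close>, because \<open>T' = \<tau>\<^sup>2 - T\<^sup>2\<close>. This is
  the one-soliton well, which a Darboux transformation turns into the zero potential.
\<close>

lemma gelfand_potential:
  "gelfand_lambda \<tau> * exp (gelfand_u x \<tau>) = 2 * (\<tau>\<^sup>2 - (\<tau> * tanh (\<tau> * x))\<^sup>2)"
proof -
  have "exp (gelfand_u x \<tau>) = (cosh \<tau> / cosh (\<tau> * x))\<^sup>2"
    by (simp add: gelfand_u_def exp_double)
  moreover have "(tanh (\<tau> * x))\<^sup>2 = 1 - 1 / (cosh (\<tau> * x))\<^sup>2"
    by (simp add: tanh_def power_divide sinh_square_eq field_simps)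
  ultimately show ?thesis
    by (simp add: gelfand_lambda_def power_divide power_mult_distrib right_diff_distrib)
qed

lemma DERIV_gelfand_superpotential:
  "((\<lambda>x. \<tau> * tanh (\<tau> * x)) has_real_derivative \<tau>\<^sup>2 - (\<tau> * tanh (\<tau> * x))\<^sup>2) (at x)"
  by (rule derivative_eq_intros refl cosh_real_nonzero)+
    (simp add: algebra_simps power2_eq_square)

text \<open>
  If \<open>\<psi>'' = - \<mu> \<psi>\<close>, then \<open>\<psi>' - T \<psi>\<close> solves the linearized equation, by the Riccati identity
  \<open>T' = \<tau>\<^sup>2 - T\<^sup>2\<close>. The pair \<open>s\<close>, \<open>c\<close> stands for the sine and cosine of the free equation: as \<open>T\<close> is
  odd, the odd \<open>\<psi> = s\<close> gives the even solution \<open>c - T s\<close>, and the even \<open>\<psi> = c\<close> gives the odd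
  solution \<open>- \<mu> s - T c\<close>. The latter has slope \<open>- (\<mu> + \<tau>\<^sup>2)\<close> at \<open>0\<close>, so the two are independent
  unless \<open>\<mu> = - \<tau>\<^sup>2\<close>.
\<close>

lemma gelfand_eigenvalue_iff_darboux:
  fixes s c :: "real \<Rightarrow> real"
  assumes s: "\<And>x. (s has_real_derivative c x) (at x)"
    and c: "\<And>x. (c has_real_derivative - \<mu> * s x) (at x)"
    and odd: "\<And>x. s (- x) = - s x" and even: "\<And>x. c (- x) = c x" and c0: "c 0 = 1"
    and \<mu>: "\<mu> \<noteq> - \<tau>\<^sup>2"
  shows "gelfand_eigenvalue \<tau> \<mu> \<longleftrightarrow>
    c 1 = \<tau> * tanh \<tau> * s 1 \<or> \<mu> * s 1 + \<tau> * tanh \<tau> * c 1 = 0"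
proof -
  define T where "T x = \<tau> * tanh (\<tau> * x)" for x
  have T: "(T has_real_derivative \<tau>\<^sup>2 - (T x)\<^sup>2) (at x)" for x
    unfolding T_def by (rule DERIV_gelfand_superpotential)
  have T_odd: "T (- x) = - T x" for x by (simp add: T_def)
  have s0: "s 0 = 0" using odd[of 0] by simp
  have "dirichlet_eigenvalue (\<lambda>x. 2 * (\<tau>\<^sup>2 - (T x)\<^sup>2)) \<mu> \<longleftrightarrow>
      c 1 - T 1 * s 1 = 0 \<or> - \<mu> * s 1 - T 1 * c 1 = 0"
  proof (rule dirichlet_eigenvalue_iff_even_odd[where
        y = "\<lambda>x. c x - T x * s x" and z = "\<lambda>x. - \<mu> * s x - T x * c x"])
    show "((\<lambda>x. c x - T x * s x) has_real_derivative
        - \<mu> * s x - (\<tau>\<^sup>2 - (T x)\<^sup>2) * s x - T x * c x) (at x)" for x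
      by (rule derivative_eq_intros s c T refl)+ (simp add: algebra_simps)
    show "((\<lambda>x. - \<mu> * s x - (\<tau>\<^sup>2 - (T x)\<^sup>2) * s x - T x * c x) has_real_derivative
        - (2 * (\<tau>\<^sup>2 - (T x)\<^sup>2) + \<mu>) * (c x - T x * s x)) (at x)" for x
      by (rule derivative_eq_intros s c T refl)+ (simp add: algebra_simps power2_eq_square)
    show "((\<lambda>x. - \<mu> * s x - T x * c x) has_real_derivative
        - \<mu> * c x - (\<tau>\<^sup>2 - (T x)\<^sup>2) * c x + \<mu> * T x * s x) (at x)" for x
      by (rule derivative_eq_intros s c T refl)+ (simp add: algebra_simps)
    show "((\<lambda>x. - \<mu> * c x - (\<tau>\<^sup>2 - (T x)\<^sup>2) * c x + \<mu> * T x * s x) has_real_derivative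
        - (2 * (\<tau>\<^sup>2 - (T x)\<^sup>2) + \<mu>) * (- \<mu> * s x - T x * c x)) (at x)" for x
      by (rule derivative_eq_intros s c T refl)+ (simp add: algebra_simps power2_eq_square)
    show "- \<mu> * c 0 - (\<tau>\<^sup>2 - (T 0)\<^sup>2) * c 0 + \<mu> * T 0 * s 0 \<noteq> 0"
      using \<mu> c0 by (simp add: T_def)
  qed (use odd even s0 c0 T_odd in simp_all)
  then show ?thesis
    unfolding gelfand_eigenvalue_def gelfand_potential T_def by (auto simp: algebra_simps)
qed

text \<open>
  At \<open>\<mu> = - \<tau>\<^sup>2\<close> the Darboux transformation annihilates \<open>cosh (\<tau> * x)\<close>. The even solution is then
  \<open>1 / cosh (\<tau> * x)\<close>; reduction of order gives the odd solution
  \<open>sinh (\<tau> * x) + \<tau> * x / cosh (\<tau> * x)\<close>, a multiple of \<open>1 / cosh (\<tau> * x)\<close> times the primitive of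
  \<open>(cosh (\<tau> * x))\<^sup>2\<close>. Both are positive at \<open>1\<close>.
\<close>

lemma not_gelfand_eigenvalue_minus_tau_squared:
  assumes "0 < \<tau>"
  shows "\<not> gelfand_eigenvalue \<tau> (- \<tau>\<^sup>2)"
proof -
  define T where "T x = \<tau> * tanh (\<tau> * x)" for x
  define y where "y x = 1 / cosh (\<tau> * x)" for x
  define z where "z x = sinh (\<tau> * x) + \<tau> * x * y x" for x
  have T: "(T has_real_derivative \<tau>\<^sup>2 - (T x)\<^sup>2) (at x)" for x
    unfolding T_def by (rule DERIV_gelfand_superpotential)
  have y: "(y has_real_derivative - T x * y x) (at x)" for x
    unfolding y_def T_def
    by (rule derivative_eq_intros refl cosh_real_nonzero)+ (simp add: tanh_def power2_eq_square)
  have Ty: "\<tau> * T x * y x = (\<tau>\<^sup>2 - (T x)\<^sup>2) * sinh (\<tau> * x)" for x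
  proof -
    have "\<tau>\<^sup>2 - (T x)\<^sup>2 = \<tau>\<^sup>2 / (cosh (\<tau> * x))\<^sup>2"
      by (simp add: T_def tanh_def power_divide power_mult_distrib sinh_square_eq field_simps)
    then show ?thesis by (simp add: T_def y_def tanh_def power2_eq_square)
  qed
  have "dirichlet_eigenvalue (\<lambda>x. 2 * (\<tau>\<^sup>2 - (T x)\<^sup>2)) (- \<tau>\<^sup>2) \<longleftrightarrow> y 1 = 0 \<or> z 1 = 0"
  proof (rule dirichlet_eigenvalue_iff_even_odd)
    show "(y has_real_derivative - T x * y x) (at x)" for x by (rule y)
    show "((\<lambda>x. - T x * y x) has_real_derivative
        - (2 * (\<tau>\<^sup>2 - (T x)\<^sup>2) + - \<tau>\<^sup>2) * y x) (at x)" for x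
      by (rule derivative_eq_intros y T refl)+ (simp add: algebra_simps power2_eq_square)
    show "(z has_real_derivative \<tau> * cosh (\<tau> * x) + \<tau> * y x - \<tau> * x * T x * y x) (at x)" for x
      unfolding z_def
      by (rule derivative_eq_intros y T refl)+ (simp add: algebra_simps)
    show "((\<lambda>x. \<tau> * cosh (\<tau> * x) + \<tau> * y x - \<tau> * x * T x * y x) has_real_derivative
        - (2 * (\<tau>\<^sup>2 - (T x)\<^sup>2) + - \<tau>\<^sup>2) * z x) (at x)" for x
      by (rule derivative_eq_intros y T refl)+
        (use Ty[of x] in \<open>simp add: z_def algebra_simps power2_eq_square\<close>)
  qed (use assms in \<open>simp_all add: y_def z_def T_def\<close>)
  moreover have "y 1 > 0" "z 1 > 0"
    using assms by (auto simp: y_def z_def intro!: add_pos_pos)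
  ultimately show ?thesis
    unfolding gelfand_eigenvalue_def gelfand_potential T_def by simp
qed

section \<open>Characteristic equations\<close>

lemma mult_tanh_strict_mono:
  fixes x y :: real
  assumes "0 \<le> x" "x < y"
  shows "x * tanh x < y * tanh y"
  using assms by (intro mult_strict_mono) auto

lemma gelfand_eigenvalue_zero_iff:
  assumes "0 < \<tau>"
  shows "gelfand_eigenvalue \<tau> 0 \<longleftrightarrow> \<tau> * tanh \<tau> = 1"
proof -
  have "gelfand_eigenvalue \<tau> 0 \<longleftrightarrow>
    (\<lambda>x::real. 1) 1 = \<tau> * tanh \<tau> * (\<lambda>x. x) 1 \<or> 0 * (\<lambda>x. x) 1 + \<tau> * tanh \<tau> * (\<lambda>x::real. 1) 1 = 0"
    by (rule gelfand_eigenvalue_iff_darboux)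
      (use assms in \<open>auto intro!: derivative_eq_intros\<close>)
  with assms show ?thesis by auto
qed

text \<open>
  With \<open>\<mu> = - \<kappa>\<^sup>2\<close> the even solution vanishes at \<open>1\<close> exactly under the stated equation. The odd one
  would need \<open>\<kappa> * tanh \<kappa> = \<tau> * tanh \<tau>\<close>, hence \<open>\<kappa> = \<tau>\<close>; but \<open>- \<tau>\<^sup>2\<close> is not an eigenvalue, and
  \<open>\<kappa> = \<tau>\<close> does not satisfy the stated equation either.
\<close>

lemma gelfand_eigenvalue_negative_iff:
  assumes "0 < \<tau>" "\<mu> < 0"
  shows "gelfand_eigenvalue \<tau> \<mu> \<longleftrightarrow> tanh (sqrt (- \<mu>)) = sqrt (- \<mu>) / (\<tau> * tanh \<tau>)"
proof -
  define \<kappa> where "\<kappa> = sqrt (- \<mu>)"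
  have \<kappa>: "0 < \<kappa>" and \<mu>: "\<mu> = - \<kappa>\<^sup>2" using assms by (auto simp: \<kappa>_def)
  have K: "0 < \<tau> * tanh \<tau>" using assms by simp
  have "gelfand_eigenvalue \<tau> \<mu> \<longleftrightarrow> tanh \<kappa> = \<kappa> / (\<tau> * tanh \<tau>)"
  proof (cases "\<kappa> = \<tau>")
    case True
    have "tanh \<tau> * tanh \<tau> < 1 * 1"
      using assms tanh_real_lt_1[of \<tau>] by (intro mult_strict_mono) auto
    then have "tanh \<tau> \<noteq> \<tau> / (\<tau> * tanh \<tau>)" using assms by (auto simp: field_simps)
    with True not_gelfand_eigenvalue_minus_tau_squared[OF assms(1)] \<mu> show ?thesis by simp
  next
    case False
    have "gelfand_eigenvalue \<tau> \<mu> \<longleftrightarrow> cosh (\<kappa> * 1) = \<tau> * tanh \<tau> * (sinh (\<kappa> * 1) / \<kappa>) \<or>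
        \<mu> * (sinh (\<kappa> * 1) / \<kappa>) + \<tau> * tanh \<tau> * cosh (\<kappa> * 1) = 0"
      by (rule gelfand_eigenvalue_iff_darboux)
        (use \<kappa> assms False in \<open>auto intro!: derivative_eq_intros simp: \<mu> power2_eq_square
            power2_eq_iff_nonneg abs_if field_simps square_eq_iff\<close>)
    moreover have "\<mu> * (sinh (\<kappa> * 1) / \<kappa>) + \<tau> * tanh \<tau> * cosh (\<kappa> * 1) =
        (\<tau> * tanh \<tau> - \<kappa> * tanh \<kappa>) * cosh \<kappa>"
      using \<kappa> by (simp add: \<mu> tanh_def[of \<kappa>] field_simps power2_eq_square)
    moreover have "\<tau> * tanh \<tau> \<noteq> \<kappa> * tanh \<kappa>"
      using mult_tanh_strict_mono[of \<kappa> \<tau>] mult_tanh_strict_mono[of \<tau> \<kappa>] False \<kappa> assms by linarith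
    moreover have "cosh (\<kappa> * 1) = \<tau> * tanh \<tau> * (sinh (\<kappa> * 1) / \<kappa>) \<longleftrightarrow>
        tanh \<kappa> = \<kappa> / (\<tau> * tanh \<tau>)"
    proof -
      have "\<kappa> \<noteq> 0" "\<tau> * tanh \<tau> \<noteq> 0" using \<kappa> K by auto
      then show ?thesis unfolding tanh_def[of \<kappa>]
        by (simp only: frac_eq_eq nonzero_eq_divide_eq nonzero_divide_eq_eq cosh_real_nonzero
            not_False_eq_True mult_1_right times_divide_eq_right times_divide_eq_left)
          (auto simp: mult.commute)
    qed
    ultimately show ?thesis by simp
  qed
  then show ?thesis by (simp add: \<kappa>_def)
qed

text \<open>
  On the branch prescribed by the bounds the cosine is positive, so the condition can be stated
  without quotients.
\<close>

lemma star_condition_iff_sin_cos: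
  assumes "0 < \<tau>" "1 \<le> j"
  shows "star_condition \<tau> j \<mu> \<longleftrightarrow>
    pi / 2 * (real j - 1) < sqrt \<mu> \<and> sqrt \<mu> < pi / 2 * real j \<and>
    \<tau> * tanh \<tau> * sin (sqrt \<mu> - pi / 2 * (real j - 1)) =
      sqrt \<mu> * cos (sqrt \<mu> - pi / 2 * (real j - 1))"
proof -
  define \<theta> where "\<theta> = sqrt \<mu> - pi / 2 * (real j - 1)"
  have "tan \<theta> = sqrt \<mu> / (\<tau> * tanh \<tau>) \<longleftrightarrow> \<tau> * tanh \<tau> * sin \<theta> = sqrt \<mu> * cos \<theta>"
    if "pi / 2 * (real j - 1) < sqrt \<mu>" "sqrt \<mu> < pi / 2 * real j"
  proof -
    have "0 < \<theta>" "\<theta> < pi / 2" using that by (auto simp: \<theta>_def right_diff_distrib)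
    then have "cos \<theta> > 0" by (intro cos_gt_zero)
    then show ?thesis using assms by (auto simp: tan_def field_simps)
  qed
  then show ?thesis unfolding star_condition_def \<theta>_def by blast
qed

lemma star_condition_pos:
  assumes "1 \<le> j" "star_condition \<tau> j \<mu>"
  shows "0 < \<mu>"
proof -
  have "0 \<le> pi / 2 * (real j - 1)" using assms by simp
  also have "\<dots> < sqrt \<mu>" using assms unfolding star_condition_def by simp
  finally show ?thesis by simp
qed

text \<open>
  For \<open>\<mu> = \<nu>\<^sup>2\<close>, \<open>K = \<tau> * tanh \<tau>\<close> and \<open>t = \<nu>\<close> the two factors are, up to nonzero constants, the
  values at \<open>1\<close> of the even and the odd solution. A rotation of \<open>t\<close> by a quarter turn exchanges them
  up to sign. This is why even and odd eigenfunctions alternate and one formula, shifted by \<open>pi / 2\<close>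
  for each \<open>j\<close>, covers both.
\<close>

lemma characteristic_product_quarter_turns:
  fixes \<nu> K t :: real
  shows "(\<nu> * cos t - K * sin t) * (\<nu> * sin t + K * cos t) = 0 \<longleftrightarrow>
    (\<nu> * cos (t - pi / 2 * real n) - K * sin (t - pi / 2 * real n)) *
    (\<nu> * sin (t - pi / 2 * real n) + K * cos (t - pi / 2 * real n)) = 0"
proof (induction n)
  case (Suc n)
  define r where "r = t - pi / 2 * real n"
  have "t - pi / 2 * real (Suc n) = r - pi / 2" by (simp add: r_def algebra_simps)
  moreover have "sin (r - pi / 2) = - cos r" "cos (r - pi / 2) = sin r"
    by (simp_all add: sin_diff cos_diff)
  ultimately show ?case using Suc.IH unfolding r_def[symmetric] by auto
qed simp

text \<open>
  Subtracting whole quarter turns from \<open>\<nu> = sqrt \<mu>\<close> leaves an angle \<open>\<theta>\<close> in \<open>[0, pi/2)\<close>. There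
  \<open>\<nu> * sin \<theta> + K * cos \<theta>\<close> is positive, so the other factor
  \<open>\<nu> * cos \<theta> - K * sin \<theta>\<close> must vanish, which excludes \<open>\<theta> = 0\<close> and is the condition
  on \<open>tan \<theta>\<close>.
\<close>

lemma gelfand_eigenvalue_positive_iff:
  assumes "0 < \<tau>" "0 < \<mu>"
  shows "gelfand_eigenvalue \<tau> \<mu> \<longleftrightarrow> (\<exists>j\<ge>1. star_condition \<tau> j \<mu>)"
proof -
  define \<nu> where "\<nu> = sqrt \<mu>"
  define K where "K = \<tau> * tanh \<tau>"
  have \<nu>: "0 < \<nu>" and \<mu>: "\<mu> = \<nu>\<^sup>2" using assms by (auto simp: \<nu>_def)
  have K: "0 < K" using assms by (simp add: K_def)
  have "\<nu>\<^sup>2 \<noteq> - \<tau>\<^sup>2" using zero_le_power2[of \<tau>] assms(2) unfolding \<mu> by linarith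
  then have "gelfand_eigenvalue \<tau> \<mu> \<longleftrightarrow> cos (\<nu> * 1) = \<tau> * tanh \<tau> * (sin (\<nu> * 1) / \<nu>) \<or>
      \<mu> * (sin (\<nu> * 1) / \<nu>) + \<tau> * tanh \<tau> * cos (\<nu> * 1) = 0"
    by (intro gelfand_eigenvalue_iff_darboux)
      (use \<nu> in \<open>auto intro!: derivative_eq_intros simp: \<mu> power2_eq_square\<close>)
  also have "\<dots> \<longleftrightarrow> (\<nu> * cos \<nu> - K * sin \<nu>) * (\<nu> * sin \<nu> + K * cos \<nu>) = 0"
    using \<nu> by (simp only: mult_eq_0_iff) (auto simp: \<mu> K_def field_simps power2_eq_square)
  finally have eigen: "gelfand_eigenvalue \<tau> \<mu> \<longleftrightarrow>
      (\<nu> * cos \<nu> - K * sin \<nu>) * (\<nu> * sin \<nu> + K * cos \<nu>) = 0" .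
  have rotated: "gelfand_eigenvalue \<tau> \<mu> \<longleftrightarrow> \<nu> * cos \<theta> = K * sin \<theta> \<or> \<nu> * sin \<theta> + K * cos \<theta> = 0"
    if "1 \<le> j" "\<theta> = \<nu> - pi / 2 * (real j - 1)" for j \<theta>
    using characteristic_product_quarter_turns[of \<nu> \<nu> K "j - 1"] that
    by (simp add: eigen of_nat_diff)
  show ?thesis
  proof
    assume ev: "gelfand_eigenvalue \<tau> \<mu>"
    define n where "n = nat \<lfloor>\<nu> / (pi / 2)\<rfloor>"
    define \<theta> where "\<theta> = \<nu> - pi / 2 * real n"
    have "0 \<le> \<nu> / (pi / 2)" using \<nu> by simp
    then have "real n \<le> \<nu> / (pi / 2)" "\<nu> / (pi / 2) < real n + 1"
      unfolding n_def by (simp_all add: of_nat_nat)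
    then have bounds: "0 \<le> \<theta>" "\<theta> < pi / 2"
      by (simp_all add: \<theta>_def field_simps)
    have cos: "0 < cos \<theta>" using bounds by (intro cos_gt_zero_pi) auto
    have sin: "0 \<le> sin \<theta>" using bounds by (intro sin_ge_zero) auto
    have "0 < \<nu> * sin \<theta> + K * cos \<theta>"
      using \<nu> K cos sin by (intro add_nonneg_pos) auto
    with rotated[of "Suc n" \<theta>] ev have eq: "\<nu> * cos \<theta> = K * sin \<theta>" by (simp add: \<theta>_def)
    have "\<theta> \<noteq> 0" using eq \<nu> by auto
    with bounds eq have "star_condition \<tau> (Suc n) \<mu>"
      using assms by (subst star_condition_iff_sin_cos)
        (auto simp: \<theta>_def \<nu>_def K_def algebra_simps)
    then show "\<exists>j\<ge>1. star_condition \<tau> j \<mu>" by (intro exI[of _ "Suc n"]) auto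
  next
    assume "\<exists>j\<ge>1. star_condition \<tau> j \<mu>"
    then obtain j where "1 \<le> j" "star_condition \<tau> j \<mu>" by blast
    with assms(1) show "gelfand_eigenvalue \<tau> \<mu>"
      by (subst rotated[of j]) (auto simp: star_condition_iff_sin_cos \<nu>_def K_def)
  qed
qed

section \<open>Solutions of the characteristic equations\<close>

lemma mult_cos_less_sin:
  fixes x :: real
  assumes "0 < x" "x \<le> pi / 2"
  shows "x * cos x < sin x"
proof -
  have "(\<lambda>x. sin x - x * cos x) 0 < (\<lambda>x. sin x - x * cos x) x"
  proof (rule DERIV_pos_imp_increasing_open[OF assms(1)])
    fix t assume "0 < t" "t < x"
    then have "0 < t * sin t" using assms by (intro mult_pos_pos sin_gt_zero) auto
    then show "\<exists>y. ((\<lambda>x. sin x - x * cos x) has_real_derivative y) (at t) \<and> y > 0"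
      by (intro exI[of _ "t * sin t"] conjI) (auto intro!: derivative_eq_intros)
  qed (auto intro!: continuous_intros)
  then show ?thesis by simp
qed

lemma less_sinh:
  fixes x :: real
  assumes "0 < x"
  shows "x < sinh x"
proof -
  have "(\<lambda>x. sinh x - x) 0 < (\<lambda>x. sinh x - x) x"
  proof (rule DERIV_pos_imp_increasing_open[OF assms])
    fix t :: real assume "0 < t"
    then have "cosh t > 1" using cosh_real_ge_1[of t] by (metis cosh_real_one_iff le_less less_irrefl)
    then show "\<exists>y. ((\<lambda>x. sinh x - x) has_real_derivative y) (at t) \<and> y > 0"
      by (intro exI[of _ "cosh t - 1"] conjI) (auto intro!: derivative_eq_intros)
  qed (auto intro!: continuous_intros)
  then show ?thesis by simp
qed

lemma sinh_less_mult_cosh: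
  fixes x :: real
  assumes "0 < x"
  shows "sinh x < x * cosh x"
proof -
  have "(\<lambda>x. x * cosh x - sinh x) 0 < (\<lambda>x. x * cosh x - sinh x) x"
  proof (rule DERIV_pos_imp_increasing_open[OF assms])
    fix t :: real assume "0 < t"
    then show "\<exists>y. ((\<lambda>x. x * cosh x - sinh x) has_real_derivative y) (at t) \<and> y > 0"
      by (intro exI[of _ "t * sinh t"] conjI) (auto intro!: derivative_eq_intros)
  qed (auto intro!: continuous_intros)
  then show ?thesis by simp
qed

lemma tan_over_shift_strict_mono:
  fixes a x y :: real
  assumes "0 \<le> a" "0 < x" "x < y" "y < pi / 2"
  shows "tan x / (x + a) < tan y / (y + a)"
proof (rule DERIV_pos_imp_increasing[OF assms(3)])
  fix t assume "x \<le> t" "t \<le> y"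
  then have t: "0 < t" "t < pi / 2" using assms by auto
  have cos: "0 < cos t" using t by (intro cos_gt_zero)
  have "sin t * cos t < t"
  proof -
    have "cos t < 1" using cos_monotone_0_pi[of 0 t] t by simp
    moreover have "0 < sin t" using t by (intro sin_gt_zero) auto
    ultimately have "sin t * cos t < sin t * 1" by (intro mult_strict_left_mono)
    with sin_x_le_x[of t] t show ?thesis by simp
  qed
  then have "0 < (t + a - sin t * cos t) / ((cos t)\<^sup>2 * (t + a)\<^sup>2)"
    using assms t cos by (intro divide_pos_pos mult_pos_pos) auto
  moreover have "((\<lambda>x. tan x / (x + a)) has_real_derivative
      (t + a - sin t * cos t) / ((cos t)\<^sup>2 * (t + a)\<^sup>2)) (at t)"
  proof -
    have "((\<lambda>x. tan x / (x + a)) has_real_derivative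
        (inverse ((cos t)\<^sup>2) * (t + a) - tan t * 1) / ((t + a) * (t + a))) (at t)"
      using cos t assms(1) by (intro DERIV_divide DERIV_tan) (auto intro!: derivative_eq_intros)
    moreover have "inverse ((cos t)\<^sup>2) * (t + a) - tan t * 1 = (t + a - sin t * cos t) / (cos t)\<^sup>2"
      using cos by (simp add: tan_def field_simps power2_eq_square)
    ultimately show ?thesis by (simp add: power2_eq_square)
  qed
  ultimately show "\<exists>d. ((\<lambda>x. tan x / (x + a)) has_real_derivative d) (at t) \<and> 0 < d" by blast
qed

lemma tanh_over_self_strict_antimono:
  fixes x y :: real
  assumes "0 < x" "x < y"
  shows "tanh y / y < tanh x / x"
proof -
  have "- (tanh x / x) < - (tanh y / y)"
  proof (rule DERIV_pos_imp_increasing[OF assms(2)])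
    fix t assume "x \<le> t" "t \<le> y"
    then have t: "0 < t" using assms by auto
    have "t * 1 < sinh t * cosh t"
      using less_sinh[OF t] cosh_real_ge_1[of t] t by (intro mult_less_le_imp_less) auto
    then have "0 < (sinh t * cosh t - t) / ((cosh t)\<^sup>2 * t\<^sup>2)"
      using t by (intro divide_pos_pos) auto
    moreover have "((\<lambda>x. - (tanh x / x)) has_real_derivative
        (sinh t * cosh t - t) / ((cosh t)\<^sup>2 * t\<^sup>2)) (at t)"
    proof (rule derivative_eq_intros refl cosh_real_nonzero)+
      have "1 - (tanh t)\<^sup>2 = 1 / (cosh t)\<^sup>2"
        by (simp add: tanh_def power_divide sinh_square_eq field_simps)
      then show "- (((1 - (tanh t)\<^sup>2) * 1 * t - tanh t * 1) / (t * t)) =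
          (sinh t * cosh t - t) / ((cosh t)\<^sup>2 * t\<^sup>2)"
        using t by (simp add: tanh_def divide_simps power2_eq_square)
    qed (use t in auto)
    ultimately show "\<exists>d. ((\<lambda>x. - (tanh x / x)) has_real_derivative d) (at t) \<and> 0 < d" by blast
  qed
  then show ?thesis by simp
qed

text \<open>
  With \<open>\<theta> = sqrt \<mu> - a\<close>, where \<open>a = pi / 2 * (real j - 1)\<close>, the condition prescribes the value of
  the injective function \<open>tan \<theta> / (\<theta> + a)\<close>.
\<close>

lemma star_condition_unique:
  assumes "0 < \<tau>" "1 \<le> j" "star_condition \<tau> j \<mu>" "star_condition \<tau> j \<nu>"
  shows "\<mu> = \<nu>"
proof -
  define a where "a = pi / 2 * (real j - 1)"
  have a: "0 \<le> a" using assms(2) by (simp add: a_def)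
  have quot: "tan (sqrt \<xi> - a) / ((sqrt \<xi> - a) + a) = 1 / (\<tau> * tanh \<tau>)"
    and bounds: "0 < sqrt \<xi> - a" "sqrt \<xi> - a < pi / 2" if "star_condition \<tau> j \<xi>" for \<xi>
    using that star_condition_pos[OF assms(2) that]
    by (auto simp: star_condition_def a_def right_diff_distrib)
  have "sqrt \<mu> - a = sqrt \<nu> - a"
    using tan_over_shift_strict_mono[OF a, of "sqrt \<mu> - a" "sqrt \<nu> - a"]
      tan_over_shift_strict_mono[OF a, of "sqrt \<nu> - a" "sqrt \<mu> - a"]
      quot[OF assms(3)] quot[OF assms(4)] bounds[OF assms(3)] bounds[OF assms(4)] by linarith
  then show ?thesis by simp
qed

text \<open>
  By the intermediate value theorem: \<open>h \<theta> = K * sin \<theta> - (\<theta> + a) * cos \<theta>\<close> is positive at \<open>pi / 2\<close>.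
  For \<open>j \<ge> 2\<close> it equals \<open>- a < 0\<close> at \<open>0\<close>; for \<open>j = 1\<close> it starts at \<open>0\<close>, and \<open>K < 1\<close> is what makes
  it negative nearby.
\<close>

lemma star_condition_exists:
  assumes "0 < \<tau>" "1 \<le> j" and first: "j = 1 \<Longrightarrow> \<tau> * tanh \<tau> < 1"
  shows "\<exists>\<mu>. star_condition \<tau> j \<mu>"
proof -
  define a where "a = pi / 2 * (real j - 1)"
  define K where "K = \<tau> * tanh \<tau>"
  define h where "h \<theta> = K * sin \<theta> - (\<theta> + a) * cos \<theta>" for \<theta>
  have a: "0 \<le> a" using assms(2) by (simp add: a_def)
  have K: "0 < K" using assms by (simp add: K_def)
  obtain \<theta>0 where \<theta>0: "0 \<le> \<theta>0" "\<theta>0 < pi / 2" "h \<theta>0 < 0"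
  proof (cases "j = 1")
    case False
    then have "0 < a" using assms(2) by (simp add: a_def)
    then show ?thesis by (intro that[of 0]) (auto simp: h_def)
  next
    case True
    \<comment> \<open>Here \<open>h 0 = 0\<close>. As \<open>sin \<theta> \<le> \<theta>\<close>, \<open>h\<close> is negative wherever \<open>cos \<theta> > K\<close>.\<close>
    define \<theta> where "\<theta> = arccos ((K + 1) / 2)"
    have K1: "K < 1" using first True by (simp add: K_def)
    have cos: "cos \<theta> = (K + 1) / 2" using K K1 by (simp add: \<theta>_def)
    have "\<theta> < arccos 0" unfolding \<theta>_def using K K1 by (intro arccos_less_arccos) auto
    moreover have "arccos 1 < \<theta>" unfolding \<theta>_def using K K1 by (intro arccos_less_arccos) auto
    ultimately have \<theta>: "0 < \<theta>" "\<theta> < pi / 2" by auto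
    have "K * sin \<theta> \<le> K * \<theta>" using K \<theta> sin_x_le_x[of \<theta>] by (intro mult_left_mono) auto
    also have "\<dots> < cos \<theta> * \<theta>" using \<theta> K1 by (intro mult_strict_right_mono) (auto simp: cos)
    finally have "h \<theta> < 0" using True by (simp add: h_def a_def mult.commute)
    with \<theta> show ?thesis by (intro that[of \<theta>]) auto
  qed
  have "\<exists>x\<ge>\<theta>0. x \<le> pi / 2 \<and> h x = 0"
  proof (rule IVT')
    show "h \<theta>0 \<le> 0" "\<theta>0 \<le> pi / 2" "0 \<le> h (pi / 2)" using \<theta>0 K by (auto simp: h_def)
    show "continuous_on {\<theta>0..pi / 2} h" unfolding h_def by (intro continuous_intros)
  qed
  then obtain \<theta> where \<theta>: "\<theta>0 \<le> \<theta>" "\<theta> \<le> pi / 2" "h \<theta> = 0" by blast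
  have "\<theta> \<noteq> \<theta>0" using \<theta> \<theta>0 by auto
  moreover have "\<theta> \<noteq> pi / 2"
  proof
    assume "\<theta> = pi / 2"
    then have "h \<theta> = K" unfolding h_def by (simp only: sin_pi_half cos_pi_half mult_1_right mult_zero_right diff_zero)
    with \<theta>(3) K show False by simp
  qed
  ultimately have bounds: "0 < \<theta>" "\<theta> < pi / 2" using \<theta> \<theta>0 by auto
  have sqrt: "sqrt ((\<theta> + a)\<^sup>2) = \<theta> + a" using bounds a by simp
  have shift: "\<theta> + a - pi / 2 * (real j - 1) = \<theta>" by (simp add: a_def)
  have lower: "pi / 2 * (real j - 1) < \<theta> + a" using bounds by (simp add: a_def)
  have "pi / 2 * real j = a + pi / 2" by (simp add: a_def field_simps)
  with bounds have upper: "\<theta> + a < pi / 2 * real j" by linarith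
  have "star_condition \<tau> j ((\<theta> + a)\<^sup>2)"
    unfolding star_condition_iff_sin_cos[OF assms(1,2)] sqrt shift
    using \<theta>(3) lower upper by (simp add: h_def K_def)
  then show ?thesis by blast
qed

lemma no_first_star_condition:
  assumes "0 < \<tau>" "1 \<le> \<tau> * tanh \<tau>"
  shows "\<not> star_condition \<tau> 1 \<mu>"
proof
  assume *: "star_condition \<tau> 1 \<mu>"
  define \<nu> where "\<nu> = sqrt \<mu>"
  from * have eq: "\<tau> * tanh \<tau> * sin \<nu> = \<nu> * cos \<nu>" and \<nu>: "0 < \<nu>" "\<nu> < pi / 2"
    using assms(1) by (simp_all add: star_condition_iff_sin_cos \<nu>_def)
  have "1 * sin \<nu> \<le> \<tau> * tanh \<tau> * sin \<nu>"
    using assms \<nu> by (intro mult_right_mono sin_ge_zero) auto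
  with eq mult_cos_less_sin[of \<nu>] \<nu> show False by simp
qed

lemma no_negative_eigenvalue:
  assumes "0 < \<tau>" "\<tau> * tanh \<tau> \<le> 1" "\<mu> < 0"
  shows "\<not> gelfand_eigenvalue \<tau> \<mu>"
proof
  define \<kappa> where "\<kappa> = sqrt (- \<mu>)"
  have \<kappa>: "0 < \<kappa>" using assms by (simp add: \<kappa>_def)
  have K: "0 < \<tau> * tanh \<tau>" using assms by simp
  assume "gelfand_eigenvalue \<tau> \<mu>"
  then have "tanh \<kappa> = \<kappa> / (\<tau> * tanh \<tau>)"
    using assms by (simp add: gelfand_eigenvalue_negative_iff \<kappa>_def)
  moreover have "\<kappa> \<le> \<kappa> / (\<tau> * tanh \<tau>)"
    using mult_left_mono[OF assms(2), of \<kappa>] \<kappa> K by (simp only: le_divide_eq) simp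
  moreover have "tanh \<kappa> < \<kappa>"
    using sinh_less_mult_cosh[OF \<kappa>] by (simp add: tanh_def divide_less_eq)
  ultimately show False by simp
qed

lemma negative_root_exists_unique:
  fixes K :: real
  assumes "1 < K"
  shows "\<exists>!\<mu>. \<mu> < 0 \<and> tanh (sqrt (- \<mu>)) = sqrt (- \<mu>) / K"
proof (rule ex_ex1I)
  define h where "h \<kappa> = K * sinh \<kappa> - \<kappa> * cosh \<kappa>" for \<kappa>
  define \<kappa>0 where "\<kappa>0 = arcosh K"
  \<comment> \<open>\<open>h\<close> is positive where \<open>cosh \<kappa> = K\<close>, because \<open>sinh \<kappa> > \<kappa>\<close>; it is negative at \<open>K\<close>, because
    \<open>sinh K < cosh K\<close>.\<close>
  have cosh0: "cosh \<kappa>0 = K" using assms by (simp add: \<kappa>0_def)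
  have pos0: "0 < \<kappa>0" using assms by (simp add: \<kappa>0_def)
  have h0: "0 < h \<kappa>0"
    using less_sinh[OF pos0] assms by (simp add: h_def cosh0 algebra_simps)
  have hK: "h K < 0" using sinh_less_cosh_real[of K] assms by (simp add: h_def)
  have "\<kappa>0 \<le> K" using less_sinh[OF pos0] sinh_less_cosh_real[of \<kappa>0] cosh0 by linarith
  then have "\<exists>x\<ge>\<kappa>0. x \<le> K \<and> h x = 0"
    using h0 hK by (intro IVT2') (auto simp: h_def intro!: continuous_intros)
  then obtain \<kappa> where \<kappa>: "0 < \<kappa>" "h \<kappa> = 0" using pos0 by (metis less_le_trans)
  then have "tanh \<kappa> = \<kappa> / K" using assms by (simp add: h_def tanh_def field_simps)
  with \<kappa> show "\<exists>\<mu>. \<mu> < 0 \<and> tanh (sqrt (- \<mu>)) = sqrt (- \<mu>) / K"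
    by (intro exI[of _ "- \<kappa>\<^sup>2"]) auto
next
  fix \<mu> \<nu> :: real
  assume \<mu>: "\<mu> < 0 \<and> tanh (sqrt (- \<mu>)) = sqrt (- \<mu>) / K"
    and \<nu>: "\<nu> < 0 \<and> tanh (sqrt (- \<nu>)) = sqrt (- \<nu>) / K"
  then have "tanh (sqrt (- \<mu>)) / sqrt (- \<mu>) = tanh (sqrt (- \<nu>)) / sqrt (- \<nu>)" by simp
  then have "sqrt (- \<mu>) = sqrt (- \<nu>)"
    using tanh_over_self_strict_antimono[of "sqrt (- \<mu>)" "sqrt (- \<nu>)"]
      tanh_over_self_strict_antimono[of "sqrt (- \<nu>)" "sqrt (- \<mu>)"] \<mu> \<nu>
    by (cases "sqrt (- \<mu>)" "sqrt (- \<nu>)" rule: linorder_cases) auto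
  then show "\<mu> = \<nu>" by simp
qed

section \<open>The threshold \<open>tau1\<close>\<close>

lemma tau1_pos_and_eq: "0 < tau1 \<and> tau1 * tanh tau1 = 1"
  unfolding tau1_def
proof (rule theI', rule ex_ex1I)
  \<comment> \<open>\<open>1 \<le> 2 * tanh 2\<close> amounts to \<open>exp 4 \<ge> 3\<close>.\<close>
  have "5 \<le> exp (4::real)" using exp_ge_add_one_self[of "4::real"] by simp
  then have "5 * exp (- 4) \<le> exp 4 * exp (- 4 :: real)" by (intro mult_right_mono) auto
  then have "5 * exp (- 4 :: real) \<le> 1" by (simp flip: exp_add)
  then have "1 \<le> 2 * tanh (2::real)"
    by (simp add: tanh_real_altdef divide_simps add_pos_pos)
  then have "\<exists>x\<ge>0. x \<le> 2 \<and> x * tanh x = (1::real)"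
    by (intro IVT'[of "\<lambda>x. x * tanh x"]) (auto intro!: continuous_intros)
  then obtain x :: real where "0 \<le> x" "x * tanh x = 1" by blast
  then show "\<exists>x::real. 0 < x \<and> x * tanh x = 1" by (intro exI[of _ x]) (auto simp: less_le)
next
  fix x y :: real
  assume "0 < x \<and> x * tanh x = 1" "0 < y \<and> y * tanh y = 1"
  then show "x = y"
    using mult_tanh_strict_mono[of x y] mult_tanh_strict_mono[of y x] by linarith
qed

lemma tau1_compare:
  assumes "0 < \<tau>"
  shows "\<tau> < tau1 \<Longrightarrow> \<tau> * tanh \<tau> < 1" "\<tau> = tau1 \<Longrightarrow> \<tau> * tanh \<tau> = 1"
    "tau1 < \<tau> \<Longrightarrow> 1 < \<tau> * tanh \<tau>"
  using tau1_pos_and_eq mult_tanh_strict_mono[of \<tau> tau1] mult_tanh_strict_mono[of tau1 \<tau>] assms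
  by auto

section \<open>Numbering of the spectrum\<close>

text \<open>
  A set of values determines its increasing enumeration. Hence the eigenvalues are numbered
  correctly as soon as the spectrum is written as an increasing sequence.
\<close>

lemma strict_mono_enumeration_unique:
  fixes f g :: "nat \<Rightarrow> 'a::linorder"
  assumes f: "strict_mono_on {m..} f" and g: "strict_mono_on {m..} g"
    and image: "f ` {m..} = g ` {m..}"
    and "m \<le> j"
  shows "f j = g j"
  using \<open>m \<le> j\<close>
proof (induction j rule: less_induct)
  case (less j)
  \<comment> \<open>The value \<open>f j\<close> is some \<open>g i\<close>; since \<open>f\<close> and \<open>g\<close> agree below \<open>j\<close> and \<open>f\<close> is injective,
    \<open>i \<ge> j\<close>.\<close>
  have le: "g' j \<le> f' j"
    if f': "strict_mono_on {m..} f'" and g': "strict_mono_on {m..} g'"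
      and im: "f' ` {m..} = g' ` {m..}" and agree: "\<And>i. m \<le> i \<Longrightarrow> i < j \<Longrightarrow> f' i = g' i"
    for f' g' :: "nat \<Rightarrow> 'a"
  proof -
    obtain i where i: "m \<le> i" "f' j = g' i" using im less.prems by force
    have "j \<le> i"
    proof (rule ccontr)
      assume "\<not> j \<le> i"
      then have "f' i = f' j" "i < j" using agree[of i] i by auto
      with strict_mono_onD[OF f', of i j] i less.prems show False by simp
    qed
    then show ?thesis
      using strict_mono_onD[OF g', of j i] i less.prems by (cases "i = j") auto
  qed
  show ?case
  proof (rule order.antisym)
    show "g j \<le> f j" by (rule le[OF f g image less.IH[rotated]])
    show "f j \<le> g j" by (rule le[OF g f image[symmetric] less.IH[rotated, symmetric]])
  qed
qed

text \<open>
  The three regimes differ only in the lowest eigenvalue \<open>e\<close>. The remaining spectrum consists of one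
  solution of the condition for each \<open>j \<ge> 2\<close>; their square roots lie in consecutive disjoint
  intervals, above \<open>sqrt e\<close>, so the sequence \<open>g\<close> below is increasing.
\<close>

lemma enumeration_of_gelfand_spectrum:
  fixes \<mu> :: "nat \<Rightarrow> real"
  assumes \<tau>: "0 < \<tau>" and mono: "strict_mono_on {1..} \<mu>"
    and image: "\<mu> ` {1..} = {\<nu>. gelfand_eigenvalue \<tau> \<nu>}"
    and spectrum: "\<And>\<nu>. gelfand_eigenvalue \<tau> \<nu> \<longleftrightarrow> \<nu> = e \<or> (\<exists>j\<ge>2. star_condition \<tau> j \<nu>)"
    and e: "star_condition \<tau> 1 e \<or> e \<le> 0"
  shows "\<mu> 1 = e" "\<And>j. 2 \<le> j \<Longrightarrow> star_condition \<tau> j (\<mu> j)"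
proof -
  define g where "g j = (if j = 1 then e else SOME \<nu>. star_condition \<tau> j \<nu>)" for j
  have g_star: "star_condition \<tau> j (g j)" if "2 \<le> j" for j
    using that star_condition_exists[OF \<tau>, of j] by (auto simp: g_def intro!: someI_ex)
  have g1: "g (Suc 0) = e" by (simp add: g_def)
  have g_unique: "\<nu> = g j" if "2 \<le> j" "star_condition \<tau> j \<nu>" for j \<nu>
    using star_condition_unique[OF \<tau>, of j] that g_star[of j] by auto
  have "strict_mono_on {1..} g"
  proof (rule strict_mono_onI)
    fix i j :: nat assume ij: "i \<in> {1..}" "j \<in> {1..}" "i < j"
    then have j: "star_condition \<tau> j (g j)" by (intro g_star) auto
    show "g i < g j"
    proof (cases "star_condition \<tau> i (g i)")
      case True
      then have "sqrt (g i) < pi / 2 * real i" by (simp add: star_condition_def)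
      also have "\<dots> \<le> pi / 2 * (real j - 1)" using ij by (intro mult_left_mono) auto
      also have "\<dots> < sqrt (g j)" using j by (simp add: star_condition_def)
      finally show ?thesis by simp
    next
      case False
      then have "i = 1" using g_star[of i] ij by (cases "i = 1") auto
      with False e have "g i \<le> 0" by (auto simp: g_def)
      also have "0 < g j" using star_condition_pos[OF _ j] ij by simp
      finally show ?thesis .
    qed
  qed
  moreover have "\<mu> ` {1..} = g ` {1..}"
  proof -
    have "g ` {1..} = insert (g 1) (g ` {2..})"
      by (simp add: image_insert[symmetric] del: image_insert) (rule arg_cong[of _ _ "image g"], auto)
    also have "\<dots> = {\<nu>. gelfand_eigenvalue \<tau> \<nu>}"
      unfolding spectrum using g_star g_unique by (auto simp: g1)
    finally show ?thesis using image by simp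
  qed
  ultimately have eq: "\<mu> j = g j" if "1 \<le> j" for j
    using strict_mono_enumeration_unique[OF mono] that by blast
  show "\<mu> 1 = e" using eq[of 1] by (simp add: g_def)
  show "star_condition \<tau> j (\<mu> j)" if "2 \<le> j" for j using eq[of j] g_star[OF that] that by simp
qed

lemma gelfand_eigenvalue_iff_cases:
  assumes "0 < \<tau>"
  shows "gelfand_eigenvalue \<tau> \<nu> \<longleftrightarrow>
    \<nu> < 0 \<and> tanh (sqrt (- \<nu>)) = sqrt (- \<nu>) / (\<tau> * tanh \<tau>) \<or>
    \<nu> = 0 \<and> \<tau> * tanh \<tau> = 1 \<or>
    star_condition \<tau> 1 \<nu> \<or> (\<exists>j\<ge>2. star_condition \<tau> j \<nu>)"
proof -
  have split: "(\<exists>j\<ge>1. P j) \<longleftrightarrow> P 1 \<or> (\<exists>j\<ge>2. P j)" for P :: "nat \<Rightarrow> bool"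
    by (metis Suc_1 le_antisym not_less_eq_eq one_le_numeral order.trans order_refl One_nat_def)
  have "\<not> star_condition \<tau> j \<nu>" if "\<nu> \<le> 0" "1 \<le> j" for j
    using star_condition_pos[of j \<tau> \<nu>] that by auto
  then have none: "\<not> (\<exists>j\<ge>1. star_condition \<tau> j \<nu>)" if "\<nu> \<le> 0" using that by blast
  show ?thesis
    using gelfand_eigenvalue_negative_iff[OF assms, of \<nu>] gelfand_eigenvalue_zero_iff[OF assms]
      gelfand_eigenvalue_positive_iff[OF assms, of \<nu>] none
    unfolding split by (cases \<nu> "0::real" rule: linorder_cases) auto
qed

theorem theorem1p1:
  fixes \<tau> :: real and \<mu> :: "nat \<Rightarrow> real"
  assumes "0 < \<tau>"
    and "strict_mono_on {1..} \<mu>"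
    and "\<mu> ` {1..} = {\<nu>. gelfand_eigenvalue \<tau> \<nu>}"
  shows "(\<tau> < tau1 \<longrightarrow>
            (\<forall>j\<ge>1. 0 < \<mu> j \<and> star_condition \<tau> j (\<mu> j) \<and>
                   (\<forall>\<nu>. star_condition \<tau> j \<nu> \<longrightarrow> \<nu> = \<mu> j))) \<and>
         (\<tau> = tau1 \<longrightarrow>
            \<mu> 1 = 0 \<and> (\<forall>j\<ge>2. 0 < \<mu> j \<and> star_condition \<tau> j (\<mu> j))) \<and>
         (\<tau> > tau1 \<longrightarrow>
            \<mu> 1 < 0 \<and>
            tanh (sqrt (- \<mu> 1)) = sqrt (- \<mu> 1) / (\<tau> * tanh \<tau>) \<and>
            (\<forall>\<nu><0. tanh (sqrt (- \<nu>)) = sqrt (- \<nu>) / (\<tau> * tanh \<tau>) \<longrightarrow> \<nu> = \<mu> 1) \<and>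
            (\<forall>j\<ge>2. 0 < \<mu> j \<and> star_condition \<tau> j (\<mu> j)))"
proof (intro conjI impI)
  note enumeration = enumeration_of_gelfand_spectrum[OF assms]
  note eigenvalues = gelfand_eigenvalue_iff_cases[OF assms(1)]
  have pos: "0 < \<mu> j \<and> star_condition \<tau> j (\<mu> j)" if "star_condition \<tau> j (\<mu> j)" "1 \<le> j" for j
    using that star_condition_pos by blast
  {
    assume "\<tau> < tau1"
    then have K: "\<tau> * tanh \<tau> < 1" using tau1_compare assms(1) by blast
    obtain e where e: "star_condition \<tau> 1 e"
      using star_condition_exists[OF assms(1), of 1] K by auto
    have "gelfand_eigenvalue \<tau> \<nu> \<longleftrightarrow> \<nu> = e \<or> (\<exists>j\<ge>2. star_condition \<tau> j \<nu>)" for \<nu>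
      using eigenvalues[of \<nu>] e K star_condition_unique[OF assms(1), of 1 e \<nu>]
        no_negative_eigenvalue[OF assms(1), of \<nu>] by auto
    note enum = enumeration[OF this disjI1[OF e]]
    have star: "star_condition \<tau> j (\<mu> j)" if "1 \<le> j" for j
      using enum e that by (cases "j = 1") auto
    then show "\<forall>j\<ge>1. 0 < \<mu> j \<and> star_condition \<tau> j (\<mu> j) \<and>
        (\<forall>\<nu>. star_condition \<tau> j \<nu> \<longrightarrow> \<nu> = \<mu> j)"
      using pos star_condition_unique[OF assms(1)] by blast
  next
    assume "\<tau> = tau1"
    then have K: "\<tau> * tanh \<tau> = 1" using tau1_compare assms(1) by blast
    have "gelfand_eigenvalue \<tau> \<nu> \<longleftrightarrow> \<nu> = 0 \<or> (\<exists>j\<ge>2. star_condition \<tau> j \<nu>)" for \<nu>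
      using eigenvalues[of \<nu>] K no_first_star_condition[OF assms(1), of \<nu>]
        no_negative_eigenvalue[OF assms(1), of \<nu>] by auto
    note enum = enumeration[OF this disjI2[OF order_refl]]
    show "\<mu> 1 = 0" by (rule enum(1))
    show "\<forall>j\<ge>2. 0 < \<mu> j \<and> star_condition \<tau> j (\<mu> j)" using enum(2) pos by simp
  next
    assume "tau1 < \<tau>"
    then have K: "1 < \<tau> * tanh \<tau>" using tau1_compare assms(1) by blast
    obtain e where e: "e < 0" "tanh (sqrt (- e)) = sqrt (- e) / (\<tau> * tanh \<tau>)"
      and unique: "\<And>\<nu>. \<nu> < 0 \<Longrightarrow> tanh (sqrt (- \<nu>)) = sqrt (- \<nu>) / (\<tau> * tanh \<tau>) \<Longrightarrow> \<nu> = e"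
      using negative_root_exists_unique[OF K] by blast
    have "gelfand_eigenvalue \<tau> \<nu> \<longleftrightarrow> \<nu> = e \<or> (\<exists>j\<ge>2. star_condition \<tau> j \<nu>)" for \<nu>
      using eigenvalues[of \<nu>] K no_first_star_condition[OF assms(1), of \<nu>] e unique[of \<nu>] by auto
    note enum = enumeration[OF this disjI2[OF less_imp_le[OF e(1)]]]
    show "\<mu> 1 < 0" "tanh (sqrt (- \<mu> 1)) = sqrt (- \<mu> 1) / (\<tau> * tanh \<tau>)"
      using enum(1) e by simp_all
    show "\<forall>\<nu><0. tanh (sqrt (- \<nu>)) = sqrt (- \<nu>) / (\<tau> * tanh \<tau>) \<longrightarrow> \<nu> = \<mu> 1"
      using enum(1) unique by blast
    show "\<forall>j\<ge>2. 0 < \<mu> j \<and> star_condition \<tau> j (\<mu> j)" using enum(2) pos by simp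
  }
qed

end
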